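(* Consider the relevance vector machine (RVM) with hyperparameters $a,b,c,d\in\mathbb{R}$ described in the context. Let $P_K=K(K^TK)^-K^T$, where $(K^TK)^-$ is a generalized inverse of $K^TK$. Then the following two conditions together are sufficient for the propriety of the posterior density $\pi(\beta,1/\sigma^2,\lambda\mid y)$ (that is, they imply $m(y)<\infty$): (i) the prior on $\lambda_i$ is a proper Gamma distribution for all $i=0,1,\dots,n$, that is, $a>0$ and $b>0$; (ii) $y^T(I-P_K)y+2d>0$ and $c>-n/2$.
   Context: Data: $(y_i,x_i)$, $i=1,\dots,n$, with $y_i\in\mathbb{R}$, $x_i\in\mathbb{R}^p$; $y=(y_1,\dots,y_n)^T$. Let $k_\theta(\cdot,\cdot)$ be a (real-valued) reproducing kernel with fixed kernel parameter $\theta$, and let $K$ be the $n\times(n+1)$ matrix whose $i$-th row is $\big(1,k_\theta(x_i,x_1),k_\theta(x_i,x_2),\dots,k_\theta(x_i,x_n)\big)$. Write $\beta=(\beta_0,\dots,\beta_n)^T\in\mathbb{R}^{n+1}$, $\lambda=(\lambda_0,\dots,\lambda_n)^T\in\mathbb{R}_+^{n+1}$, $\mathbb{R}_+=(0,\infty)$, $D=\mathrm{diag}(\lambda_0,\dots,\lambda_n)$. A generalized inverse of a matrix $A$ is a matrix $A^-$ with $AA^-A=A$. The RVM with hyperparameters $a,b,c,d\in\mathbb{R}$ is the hierarchical model $$y\mid\beta,\sigma^2\sim N(K\beta,\sigma^2 I),\qquad \beta\mid\lambda\sim N(0,D^{-1}),$$ $$\pi(\lambda_i)\propto\lambda_i^{a-1}\exp\{-b\lambda_i\}\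 (i=0,\dots,n),\qquad \pi\Big(\frac1{\sigma^2}\Big)\propto\Big(\frac1{\sigma^2}\Big)^{c-1}\exp\Big\{-\frac{d}{\sigma^2}\Big\},$$ where $\sigma^2,\lambda_0,\dots,\lambda_n$ are a priori independent and $\beta$ and $\sigma^2$ are a priori independent. The priors on $\lambda_i$ and $1/\sigma^2$ are in general allowed to be improper (not integrable). The joint prior is the product $\pi(\beta,1/\sigma^2,\lambda)=\pi(\beta\mid\lambda)\,\pi(1/\sigma^2)\prod_{i=0}^n\pi(\lambda_i)$, with $\pi(\beta\mid\lambda)$ the $N(0,D^{-1})$ density. With $f(y\mid\beta,\sigma^2)$ the $N(K\beta,\sigma^2I)$ density, define $$m(y)=\int_{\mathbb{R}_+^{n+1}}\int_{\mathbb{R}_+}\int_{\mathbb{R}^{n+1}} f(y\mid\beta,\sigma^2)\,\pi(\beta,1/\sigma^2,\lambda)\,d\beta\,d\tfrac{1}{\sigma^2}\,d\lambda,$$ and the posterior density $\pi(\beta,1/\sigma^2,\lambda\mid y)=f(y\mid\beta,\sigma^2)\pi(\beta,1/\sigma^2,\lambda)/m(y)$. The posterior density is proper if and only if $m(y)<\infty$. *)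

theory Defs
  imports "HOL-Analysis.Analysis"
begin

text \<open>
  The sample size is \<open>CARD('n)\<close>; the index set \<open>0, 1, \<dots>, n\<close> of \<open>\<beta>\<close> and \<open>\<lambda>\<close> is the type
  \<open>'n option\<close>, with \<open>None\<close> playing the role of the index 0.
\<close>

text \<open>
  A Hilbert space of real functions on \<open>'x\<close> with inner product \<open>ip\<close> (only its values on \<open>H\<close>
  matter) in which \<open>k\<close> has the reproducing property.
\<close>

definition rkhs_with_kernel ::
    "('x \<Rightarrow> real) set \<Rightarrow> (('x \<Rightarrow> real) \<Rightarrow> ('x \<Rightarrow> real) \<Rightarrow> real) \<Rightarrow> ('x \<Rightarrow> 'x \<Rightarrow> real) \<Rightarrow> bool" where
  "rkhs_with_kernel H ip k \<longleftrightarrow>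
     (\<lambda>_. 0) \<in> H \<and>
     (\<forall>f\<in>H. \<forall>g\<in>H. (\<lambda>t. f t + g t) \<in> H) \<and>
     (\<forall>r. \<forall>f\<in>H. (\<lambda>t. r * f t) \<in> H) \<and>
     (\<forall>f\<in>H. \<forall>g\<in>H. ip f g = ip g f) \<and>
     (\<forall>f\<in>H. \<forall>g\<in>H. \<forall>h\<in>H. ip (\<lambda>t. f t + g t) h = ip f h + ip g h) \<and>
     (\<forall>r. \<forall>f\<in>H. \<forall>g\<in>H. ip (\<lambda>t. r * f t) g = r * ip f g) \<and>
     (\<forall>f\<in>H. 0 \<le> ip f f) \<and>
     (\<forall>f\<in>H. ip f f = 0 \<longrightarrow> f = (\<lambda>_. 0)) \<and>
     (\<forall>s :: nat \<Rightarrow> 'x \<Rightarrow> real.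
        range s \<subseteq> H \<and>
        (\<forall>e>0. \<exists>N. \<forall>i\<ge>N. \<forall>j\<ge>N. sqrt (ip (\<lambda>t. s i t - s j t) (\<lambda>t. s i t - s j t)) < e) \<longrightarrow>
        (\<exists>f\<in>H. (\<lambda>i. sqrt (ip (\<lambda>t. s i t - f t) (\<lambda>t. s i t - f t))) \<longlonglongrightarrow> 0)) \<and>
     (\<forall>x. (\<lambda>t. k t x) \<in> H) \<and>
     (\<forall>f\<in>H. \<forall>x. f x = ip f (\<lambda>t. k t x))"

definition reproducing_kernel :: "('x \<Rightarrow> 'x \<Rightarrow> real) \<Rightarrow> bool" where
  "reproducing_kernel k \<longleftrightarrow> (\<exists>H ip. rkhs_with_kernel H ip k)"

definition kernel_design :: "('x \<Rightarrow> 'x \<Rightarrow> real) \<Rightarrow> ('n \<Rightarrow> 'x) \<Rightarrow> real ^ ('n option) ^ ('n::finite)" where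
  "kernel_design k x = (\<chi> i j. case j of None \<Rightarrow> 1 | Some j' \<Rightarrow> k (x i) (x j'))"

definition generalized_inverse :: "real ^ 'n ^ 'm \<Rightarrow> real ^ 'm ^ 'n \<Rightarrow> bool" where
  "generalized_inverse A G \<longleftrightarrow> A ** G ** A = A"

definition diag_mat :: "real ^ 'n \<Rightarrow> real ^ 'n ^ 'n" where
  "diag_mat v = (\<chi> i j. if i = j then v $ i else 0)"

text \<open>
  The parameter \<open>\<Sigma>\<close> is the covariance matrix, meant to be symmetric positive definite.
\<close>

definition mvn_density :: "real ^ 'n \<Rightarrow> real ^ 'n ^ 'n \<Rightarrow> real ^ 'n \<Rightarrow> real" where
  "mvn_density \<mu> \<Sigma> z =
     exp (- ((z - \<mu>) \<bullet> (matrix_inv \<Sigma> *v (z - \<mu>))) / 2) / sqrt ((2 * pi) ^ CARD('n) * det \<Sigma>)"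

text \<open>
  Equality up to a positive multiplicative constant. Improper priors are determined only up to
  such a constant; a proper prior is the instance where the constant normalizes it.
\<close>

definition proportional_on :: "'a set \<Rightarrow> ('a \<Rightarrow> real) \<Rightarrow> ('a \<Rightarrow> real) \<Rightarrow> bool" where
  "proportional_on S f g \<longleftrightarrow> (\<exists>C>0. \<forall>z\<in>S. f z = C * g z)"

definition gamma_kernel :: "real \<Rightarrow> real \<Rightarrow> real \<Rightarrow> real" where
  "gamma_kernel a b z = z powr (a - 1) * exp (- b * z)"

text \<open>
  In the following, \<open>u\<close> is the precision \<open>1/\<sigma>\<^sup>2\<close>, so that \<open>\<sigma>\<^sup>2 I\<close> is \<open>mat (1 / u)\<close>; \<open>l\<close> is the vector
  \<open>\<lambda>\<close>; \<open>pl i\<close> is the prior of \<open>\<lambda>\<^sub>i\<close> and \<open>pu\<close> the prior of \<open>u\<close>.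
\<close>

definition rvm_likelihood ::
    "real ^ ('n option) ^ ('n::finite) \<Rightarrow> real ^ 'n \<Rightarrow> real ^ ('n option) \<Rightarrow> real \<Rightarrow> real" where
  "rvm_likelihood K y \<beta> u = mvn_density (K *v \<beta>) (mat (1 / u)) y"

definition rvm_prior ::
    "(('n::finite) option \<Rightarrow> real \<Rightarrow> real) \<Rightarrow> (real \<Rightarrow> real) \<Rightarrow>
     real ^ ('n option) \<Rightarrow> real \<Rightarrow> real ^ ('n option) \<Rightarrow> real" where
  "rvm_prior pl pu \<beta> u l =
     mvn_density 0 (matrix_inv (diag_mat l)) \<beta> * pu u * (\<Prod>i\<in>UNIV. pl i (l $ i))"

definition rvm_marginal ::
    "real ^ ('n option) ^ ('n::finite) \<Rightarrow> ('n option \<Rightarrow> real \<Rightarrow> real) \<Rightarrow> (real \<Rightarrow> real) \<Rightarrow>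
     real ^ 'n \<Rightarrow> ennreal" where
  "rvm_marginal K pl pu y =
     (\<integral>\<^sup>+ l \<in> {l. \<forall>i. 0 < l $ i}.
        (\<integral>\<^sup>+ u \<in> {0<..}.
           (\<integral>\<^sup>+ \<beta>. ennreal (rvm_likelihood K y \<beta> u * rvm_prior pl pu \<beta> u l) \<partial>lborel)
         \<partial>lborel)
      \<partial>lborel)"

end

theory Submission
  imports Defs "HOL-Probability.Distributions"
begin

text \<open>
  The residual \<open>y - P y\<close> is orthogonal to the column space of \<open>K\<close>, so
  \<open>\<parallel>y - K \<beta>\<parallel>\<^sup>2 \<ge> y\<^sup>T (I - P) y\<close> for every \<open>\<beta>\<close>, with the right-hand side free of \<open>\<beta>\<close>
  (\<open>residual_lower_bound\<close>). Hence the likelihood is at most a constant times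
  \<open>u\<^sup>n\<^sup>/\<^sup>2 exp (- u y\<^sup>T (I - P) y / 2)\<close>, where \<open>u = 1 / \<sigma>\<^sup>2\<close>. Multiplied by the prior of
  \<open>u\<close>, this bound is the gamma kernel with shape \<open>c + n / 2\<close> and rate
  \<open>y\<^sup>T (I - P) y / 2 + d\<close>, both positive by hypothesis.

  After this replacement the integrand is a product of a function of \<open>u\<close>, a function of
  \<open>\<lambda>\<close> and the normal density of \<open>\<beta>\<close> given \<open>\<lambda>\<close>. The last one integrates to 1 whatever
  \<open>\<lambda>\<close> is (\<open>nn_integral_mvn_density_diag_mat\<close>), and what remains is a product of
  one-dimensional gamma integrals, all finite (\<open>nn_integral_gamma_kernel_finite\<close>).
\<close>

section \<open>Orthogonal projection by a generalized inverse\<close>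

text \<open>
  For a generalized inverse \<open>G\<close> of \<open>K\<^sup>T K\<close>, the transpose of \<open>G\<close> is one too, since \<open>K\<^sup>T K\<close> is
  symmetric. So \<open>q = G\<^sup>T K\<^sup>T K v - v\<close> satisfies \<open>K\<^sup>T K q = 0\<close>, whence \<open>\<parallel>K q\<parallel>\<^sup>2 = q\<^sup>T K\<^sup>T K q = 0\<close>.
\<close>

lemma mult_transpose_ginv_gram:
  fixes K :: "real ^ 'm ^ 'n"
  assumes "generalized_inverse (transpose K ** K) G"
  shows "K *v (transpose G *v ((transpose K ** K) *v v)) = K *v v"
proof -
  define A where "A = transpose K ** K"
  have symA: "transpose A = A"
    by (simp add: A_def matrix_transpose_mul)
  have "transpose (A ** G ** A) = A"
    using assms symA by (simp add: generalized_inverse_def A_def)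
  then have AGA: "A ** (transpose G ** A) = A"
    by (simp add: matrix_transpose_mul symA)
  define q where "q = transpose G *v (A *v v) - v"
  have "A *v q = (A ** (transpose G ** A)) *v v - A *v v"
    by (simp add: q_def matrix_vector_mult_diff_distrib matrix_vector_mul_assoc matrix_mul_assoc)
  then have "A *v q = 0"
    by (simp add: AGA)
  moreover have "(K *v q) \<bullet> (K *v q) = q \<bullet> (A *v q)"
    by (simp add: A_def dot_lmul_matrix[symmetric] vector_transpose_matrix
        matrix_vector_mul_assoc[symmetric] inner_commute)
  ultimately have "K *v q = 0"
    by simp
  then show ?thesis
    by (simp add: q_def matrix_vector_mult_diff_distrib A_def)
qed

lemma residual_orthogonal:
  fixes K :: "real ^ 'm ^ 'n"
  assumes "generalized_inverse (transpose K ** K) G"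
  shows "(y - (K ** G ** transpose K) *v y) \<bullet> (K *v v) = 0"
proof -
  have "((K ** G ** transpose K) *v y) \<bullet> (K *v v)
      = y \<bullet> (transpose (K ** G ** transpose K) *v (K *v v))"
    by (metis dot_lmul_matrix inner_commute vector_transpose_matrix transpose_transpose)
  also have "\<dots> = y \<bullet> (K *v (transpose G *v ((transpose K ** K) *v v)))"
    by (simp add: matrix_transpose_mul matrix_vector_mul_assoc matrix_mul_assoc)
  also have "\<dots> = y \<bullet> (K *v v)"
    by (simp only: mult_transpose_ginv_gram[OF assms])
  finally show ?thesis
    by (simp add: inner_diff_left)
qed

text \<open>
  Pythagoras: \<open>y - K \<beta>\<close> is the residual \<open>y - P y\<close> plus a vector in the column space of \<open>K\<close>. For
  the same reason the squared length of the residual is \<open>y\<^sup>T (I - P) y\<close>.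
\<close>

lemma residual_lower_bound:
  fixes K :: "real ^ 'm ^ 'n"
  assumes "generalized_inverse (transpose K ** K) G" and P: "P = K ** G ** transpose K"
  shows "y \<bullet> ((mat 1 - P) *v y) \<le> (norm (y - K *v \<beta>))\<^sup>2"
proof -
  define r where "r = y - P *v y"
  define v where "v = G *v (transpose K *v y)"
  have orth: "r \<bullet> (K *v w) = 0" for w
    using residual_orthogonal[OF assms(1)] by (simp add: r_def P)
  have Py: "P *v y = K *v v"
    by (simp add: P v_def matrix_vector_mul_assoc matrix_mul_assoc del: transpose_matrix_vector)
  have split: "y - K *v \<beta> = r + K *v (v - \<beta>)"
    by (simp add: r_def Py matrix_vector_mult_diff_distrib)
  have "(mat 1 - P) *v y = r"
    by (simp add: r_def matrix_vector_mult_diff_rdistrib)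
  moreover have "y = r + K *v v"
    by (simp add: r_def Py)
  ultimately have "y \<bullet> ((mat 1 - P) *v y) = r \<bullet> r"
    by (metis orth inner_add_left inner_commute add.right_neutral)
  also have "\<dots> \<le> r \<bullet> r + (K *v (v - \<beta>)) \<bullet> (K *v (v - \<beta>))"
    by simp
  also have "\<dots> = (norm (y - K *v \<beta>))\<^sup>2"
    by (simp add: split power2_norm_eq_inner inner_add_left inner_add_right orth
        inner_commute[of "K *v (v - \<beta>)" r])
  finally show ?thesis .
qed

section \<open>Normal densities with diagonal covariance\<close>

lemma matrix_inv_eqI:
  fixes A :: "real ^ 'm ^ 'n"
  assumes "A ** B = mat 1" "B ** A = mat 1"
  shows "matrix_inv A = B"
proof -
  have "A ** matrix_inv A = mat 1 \<and> matrix_inv A ** A = mat 1"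
    unfolding matrix_inv_def by (rule someI[of _ B]) (simp add: assms)
  then have inv: "A ** matrix_inv A = mat 1"
    by simp
  have "matrix_inv A = (B ** A) ** matrix_inv A"
    by (simp add: assms(2))
  also have "\<dots> = B ** (A ** matrix_inv A)"
    by (simp add: matrix_mul_assoc)
  also have "\<dots> = B"
    by (simp add: inv)
  finally show ?thesis .
qed

lemma matrix_inv_diag_mat:
  fixes v :: "real ^ 'm"
  assumes "\<And>i. v $ i \<noteq> 0"
  shows "matrix_inv (diag_mat v) = diag_mat (\<chi> i. 1 / v $ i)"
proof (rule matrix_inv_eqI)
  show "diag_mat v ** diag_mat (\<chi> i. 1 / v $ i) = mat 1"
    using assms by (simp add: diag_mat_def matrix_matrix_mult_def mat_def vec_eq_iff
        mult_delta_left)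
  show "diag_mat (\<chi> i. 1 / v $ i) ** diag_mat v = mat 1"
    using assms by (simp add: diag_mat_def matrix_matrix_mult_def mat_def vec_eq_iff
        mult_delta_left)
qed

lemma det_diag_mat: "det (diag_mat v) = (\<Prod>i\<in>UNIV. v $ i)"
  for v :: "real ^ 'm"
  by (subst det_diagonal) (auto simp: diag_mat_def)

lemma diag_mat_mult_vec: "diag_mat v *v z = (\<chi> i. v $ i * z $ i)"
  for v z :: "real ^ 'm"
  by (simp add: diag_mat_def matrix_vector_mult_def vec_eq_iff
      mult_delta_left)

lemma mvn_density_diag_mat:
  fixes v :: "real ^ 'm"
  assumes v: "\<And>i. 0 < v $ i"
  shows "mvn_density \<mu> (diag_mat v) z = (\<Prod>i\<in>UNIV. normal_density (\<mu> $ i) (sqrt (v $ i)) (z $ i))"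
proof -
  have "v $ i \<noteq> 0" for i
    using v[of i] by simp
  then have "(z - \<mu>) \<bullet> (matrix_inv (diag_mat v) *v (z - \<mu>))
      = (\<Sum>i\<in>UNIV. (z $ i - \<mu> $ i)\<^sup>2 / v $ i)"
    by (simp add: matrix_inv_diag_mat diag_mat_mult_vec inner_vec_def power2_eq_square)
  then have "exp (- ((z - \<mu>) \<bullet> (matrix_inv (diag_mat v) *v (z - \<mu>))) / 2)
      = (\<Prod>i\<in>UNIV. exp (- (z $ i - \<mu> $ i)\<^sup>2 / (2 * v $ i)))"
    by (simp add: exp_sum[symmetric] sum_negf sum_divide_distrib mult.commute)
  moreover have "sqrt ((2 * pi) ^ CARD('m) * det (diag_mat v)) = (\<Prod>i\<in>UNIV. sqrt (2 * pi * v $ i))"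
  proof -
    have "sqrt (\<Prod>i\<in>F. f i) = (\<Prod>i\<in>F. sqrt (f i))" for F and f :: "'m \<Rightarrow> real"
      by (induction F rule: infinite_finite_induct) (auto simp: real_sqrt_mult)
    then show ?thesis
      by (simp add: det_diag_mat real_sqrt_mult real_sqrt_power prod.distrib power_mult_distrib)
  qed
  ultimately show ?thesis
    using v by (simp add: mvn_density_def normal_density_def prod.distrib prod_dividef less_imp_le)
qed

lemma nn_integral_lborel_prod_vec:
  fixes f :: "'m::finite \<Rightarrow> real \<Rightarrow> ennreal"
  assumes "\<And>i. f i \<in> borel_measurable borel"
  shows "(\<integral>\<^sup>+ z. (\<Prod>i\<in>UNIV. f i (z $ i)) \<partial>(lborel :: (real ^ 'm) measure))
       = (\<Prod>i\<in>UNIV. \<integral>\<^sup>+ t. f i t \<partial>lborel)"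
proof -
  \<comment> \<open>The product formula for Lebesgue measure ranges over \<open>Basis\<close>, so \<open>f\<close> is reindexed along
    the bijection from coordinates to unit vectors.\<close>
  define g where "g b = f (THE i. b = axis i 1)" for b :: "real ^ 'm"
  have g: "g (axis i 1) = f i" for i
    by (simp add: g_def axis_eq_axis)
  have inj: "inj (\<lambda>i :: 'm. axis i (1 :: real))"
    by (simp add: inj_def axis_eq_axis)
  have Basis: "(Basis :: (real ^ 'm) set) = range (\<lambda>i. axis i 1)"
    by (auto simp: Basis_vec_def)
  have "(\<integral>\<^sup>+ z. (\<Prod>b\<in>Basis. g b (z \<bullet> b)) \<partial>(lborel :: (real ^ 'm) measure))
      = (\<Prod>b\<in>Basis. \<integral>\<^sup>+ t. g b t \<partial>lborel)"
    by (rule nn_integral_lborel_prod) (auto simp: Basis g assms)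
  then show ?thesis
    unfolding Basis by (simp add: prod.reindex[OF inj] g inner_axis)
qed

lemma nn_integral_normal_density:
  assumes "0 < \<sigma>"
  shows "(\<integral>\<^sup>+ t. ennreal (normal_density \<mu> \<sigma> t) \<partial>lborel) = 1"
  using prob_space.emeasure_space_1[OF prob_space_normal_density[OF assms]]
  by (simp add: emeasure_density)

text \<open>
  By \<open>mvn_density_diag_mat\<close> the coordinates are independent, so the integral is a product of
  one-dimensional normal integrals.
\<close>

lemma nn_integral_mvn_density_diag_mat:
  fixes v :: "real ^ 'm"
  assumes "\<And>i. 0 < v $ i"
  shows "(\<integral>\<^sup>+ z. ennreal (mvn_density \<mu> (diag_mat v) z) \<partial>lborel) = 1"
proof -
  have "(\<integral>\<^sup>+ z. ennreal (mvn_density \<mu> (diag_mat v) z) \<partial>lborel)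
      = (\<integral>\<^sup>+ z. (\<Prod>i\<in>UNIV. ennreal (normal_density (\<mu> $ i) (sqrt (v $ i)) (z $ i))) \<partial>lborel)"
    using assms by (simp add: mvn_density_diag_mat prod_ennreal)
  also have "\<dots> = (\<Prod>i\<in>UNIV. \<integral>\<^sup>+ t. ennreal (normal_density (\<mu> $ i) (sqrt (v $ i)) t) \<partial>lborel)"
    by (rule nn_integral_lborel_prod_vec) measurable
  also have "\<dots> = 1"
    using assms by (simp add: nn_integral_normal_density)
  finally show ?thesis .
qed

section \<open>Gamma integrals\<close>

text \<open>
  The substitution \<open>t = b z\<close> reduces the integral to the Euler integral of \<open>Gamma a\<close>.
\<close>

lemma nn_integral_gamma_kernel_finite:
  assumes "0 < a" "0 < b"
  shows "(\<integral>\<^sup>+ z\<in>{0<..}. ennreal (gamma_kernel a b z) \<partial>lborel) < \<infinity>"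
proof -
  define e where "e t = ennreal (indicator {0..} t * t powr (a - 1) / exp t)" for t
  have e [measurable]: "e \<in> borel_measurable borel"
    unfolding e_def by measurable
  have "e (0 + b * z) * ennreal (b powr (1 - a))
      \<ge> ennreal (gamma_kernel a b z) * indicator {0<..} z" for z
  proof (cases "0 < z")
    case True
    have "(b * z) powr (a - 1) * b powr (1 - a) = z powr (a - 1)"
      using True assms by (simp add: powr_mult powr_add[symmetric] mult.commute mult.left_commute)
    then have "(b * z) powr (a - 1) / exp (b * z) * b powr (1 - a) = gamma_kernel a b z"
      by (simp add: gamma_kernel_def exp_minus field_simps)
    then show ?thesis
      using True assms by (simp add: e_def ennreal_mult'[symmetric])
  qed simp
  then have "(\<integral>\<^sup>+ z\<in>{0<..}. ennreal (gamma_kernel a b z) \<partial>lborel)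
      \<le> (\<integral>\<^sup>+ z. e (0 + b * z) * ennreal (b powr (1 - a)) \<partial>lborel)"
    by (intro nn_integral_mono)
  also have "\<dots> = (\<integral>\<^sup>+ z. e (0 + b * z) \<partial>lborel) * ennreal (b powr (1 - a))"
    by (rule nn_integral_multc) simp
  also have "\<dots> < \<infinity>"
  proof -
    have "ennreal \<bar>b\<bar> * (\<integral>\<^sup>+ z. e (0 + b * z) \<partial>lborel) = (\<integral>\<^sup>+ t. e t \<partial>lborel)"
      using assms by (intro nn_integral_real_affine[symmetric]) auto
    also have "\<dots> = ennreal (Gamma a)"
      unfolding e_def using Gamma_conv_nn_integral_real[OF assms(1)] by simp
    finally have "(\<integral>\<^sup>+ z. e (0 + b * z) \<partial>lborel) \<noteq> \<infinity>"
      using assms by (auto simp: ennreal_mult_top)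
    then show ?thesis
      by (simp add: ennreal_mult_less_top less_top)
  qed
  finally show ?thesis .
qed

section \<open>Propriety of the posterior\<close>

text \<open>
  The likelihood depends on \<open>\<beta>\<close> only through the residual sum of squares, and its normalizing
  factor contributes the power \<open>u\<^sup>n\<^sup>/\<^sup>2\<close> that raises the shape of the prior of \<open>u\<close>.
\<close>

lemma rvm_likelihood_eq:
  fixes y :: "real ^ 'n"
  assumes u: "0 < u"
  shows "rvm_likelihood K y \<beta> u
       = (2 * pi) powr (- real CARD('n) / 2) * u powr (real CARD('n) / 2)
         * exp (- u * (norm (y - K *v \<beta>))\<^sup>2 / 2)"
proof -
  have "(mat (1 / u) :: real ^ 'n ^ 'n) = diag_mat (\<chi> i. 1 / u)"
    by (simp add: mat_def diag_mat_def vec_eq_iff)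
  then have "rvm_likelihood K y \<beta> u
      = (\<Prod>i\<in>UNIV. normal_density ((K *v \<beta>) $ i) (sqrt (1 / u)) (y $ i))"
    using u by (simp add: rvm_likelihood_def mvn_density_diag_mat)
  also have "\<dots> = (\<Prod>i\<in>(UNIV :: 'n set). (2 * pi) powr (- 1 / 2) * u powr (1 / 2))
      * (\<Prod>i\<in>UNIV. exp (- u * (y $ i - (K *v \<beta>) $ i)\<^sup>2 / 2))"
    unfolding prod.distrib[symmetric]
  proof (intro prod.cong refl)
    fix i
    have "1 / sqrt (2 * pi * (sqrt (1 / u))\<^sup>2) = (2 * pi) powr (- 1 / 2) * u powr (1 / 2)"
      using u by (simp add: powr_minus powr_half_sqrt real_sqrt_divide field_simps)
    moreover have "- (y $ i - (K *v \<beta>) $ i)\<^sup>2 / (2 * (sqrt (1 / u))\<^sup>2)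
        = - u * (y $ i - (K *v \<beta>) $ i)\<^sup>2 / 2"
      using u by (simp add: field_simps)
    ultimately show "normal_density ((K *v \<beta>) $ i) (sqrt (1 / u)) (y $ i)
        = (2 * pi) powr (- 1 / 2) * u powr (1 / 2) * exp (- u * (y $ i - (K *v \<beta>) $ i)\<^sup>2 / 2)"
      unfolding normal_density_def by simp
  qed
  also have "(\<Prod>i\<in>UNIV. exp (- u * (y $ i - (K *v \<beta>) $ i)\<^sup>2 / 2))
      = exp (- u * (norm (y - K *v \<beta>))\<^sup>2 / 2)"
    unfolding power2_norm_eq_inner inner_vec_def
    by (simp add: exp_sum[symmetric] sum_distrib_left sum_divide_distrib sum_negf power2_eq_square)
  also have "(\<Prod>i\<in>(UNIV :: 'n set). (2 * pi) powr (- 1 / 2) * u powr (1 / 2))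
      = (2 * pi) powr (- real CARD('n) / 2) * u powr (real CARD('n) / 2)"
    using u by (simp add: power_mult_distrib powr_power)
  finally show ?thesis .
qed

theorem theorem2p2:
  fixes k :: "'t \<Rightarrow> real ^ 'p \<Rightarrow> real ^ 'p \<Rightarrow> real"
    and \<theta> :: 't
    and x :: "'n::finite \<Rightarrow> real ^ 'p"
    and y :: "real ^ 'n"
    and a b c d :: real
    and pl :: "'n option \<Rightarrow> real \<Rightarrow> real"
    and pu :: "real \<Rightarrow> real"
    and K :: "real ^ ('n option) ^ 'n"
    and G :: "real ^ ('n option) ^ ('n option)"
    and P :: "real ^ 'n ^ 'n"
  assumes kernel: "reproducing_kernel (k \<theta>)"
    and K: "K = kernel_design (k \<theta>) x"
    and prior_lambda: "\<And>i. proportional_on {0<..} (pl i) (gamma_kernel a b)"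
    and prior_precision: "proportional_on {0<..} pu (gamma_kernel c d)"
    and ginv: "generalized_inverse (transpose K ** K) G"
    and P: "P = K ** G ** transpose K"
    and i: "a > 0" "b > 0"
    and ii: "y \<bullet> ((mat 1 - P) *v y) + 2 * d > 0" "c > - real CARD('n) / 2"
  shows "rvm_marginal K pl pu y < \<infinity>"
proof -
  define N where "N = real CARD('n)"
  define S where "S = y \<bullet> ((mat 1 - P) *v y)"
  \<comment> \<open>Shape and rate of the gamma kernel in \<open>u\<close> that dominates likelihood times prior.\<close>
  define A where "A = c + N / 2"
  define B where "B = S / 2 + d"
  obtain Cu where Cu: "0 < Cu" "\<And>u. 0 < u \<Longrightarrow> pu u = Cu * gamma_kernel c d u"
    using prior_precision by (auto simp: proportional_on_def)
  obtain Cl where Cl: "\<And>i. 0 < Cl i" "\<And>i t. 0 < t \<Longrightarrow> pl i t = Cl i * gamma_kernel a b t"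
    using prior_lambda unfolding proportional_on_def by (metis greaterThan_iff)
  define C where "C = (2 * pi) powr (- N / 2) * Cu * (\<Prod>i\<in>UNIV. Cl i)"
  define L where "L l = (\<Prod>i\<in>UNIV. gamma_kernel a b (l $ i))" for l :: "real ^ 'n option"
  have kernel_nonneg: "0 \<le> gamma_kernel p q t" for p q t
    by (simp add: gamma_kernel_def)
  have C: "0 \<le> C"
    using Cu(1) Cl(1) by (simp add: C_def prod_nonneg less_imp_le)
  have L: "0 \<le> L l" for l
    by (simp add: L_def prod_nonneg kernel_nonneg)

  \<comment> \<open>On the right-hand side \<open>\<beta>\<close> occurs only in its conditional prior density, and \<open>u\<close> and \<open>l\<close>
    are separated, so the three integrals can be taken one after the other.\<close>
  have pointwise: "rvm_likelihood K y \<beta> u * rvm_prior pl pu \<beta> u l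
      \<le> C * L l * gamma_kernel A B u * mvn_density 0 (matrix_inv (diag_mat l)) \<beta>"
    if u: "0 < u" and l: "\<And>i. 0 < l $ i" for \<beta> u l
  proof -
    have "S \<le> (norm (y - K *v \<beta>))\<^sup>2"
      unfolding S_def by (rule residual_lower_bound[OF ginv P])
    then have "exp (- u * (norm (y - K *v \<beta>))\<^sup>2 / 2) \<le> exp (- u * S / 2)"
      using u by simp
    then have lik: "rvm_likelihood K y \<beta> u
        \<le> (2 * pi) powr (- N / 2) * u powr (N / 2) * exp (- u * S / 2)"
      unfolding rvm_likelihood_eq[OF u] N_def by (intro mult_left_mono) auto
    have "0 < l $ i" "l $ i \<noteq> 0" for i
      using l[of i] by auto
    then have mvn: "0 \<le> mvn_density 0 (matrix_inv (diag_mat l)) \<beta>"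
      by (simp add: matrix_inv_diag_mat mvn_density_diag_mat prod_nonneg)
    have prior: "rvm_prior pl pu \<beta> u l = mvn_density 0 (matrix_inv (diag_mat l)) \<beta>
        * (Cu * gamma_kernel c d u) * ((\<Prod>i\<in>UNIV. Cl i) * L l)"
      using u l by (simp add: rvm_prior_def Cu Cl L_def prod.distrib)
    have nonneg: "0 \<le> rvm_prior pl pu \<beta> u l"
      unfolding prior using mvn Cu(1) Cl(1) L
      by (intro mult_nonneg_nonneg prod_nonneg) (auto simp: kernel_nonneg less_imp_le)
    have gamma: "u powr (N / 2) * exp (- u * S / 2) * gamma_kernel c d u = gamma_kernel A B u"
    proof -
      have "u powr (N / 2) * u powr (c - 1) = u powr (A - 1)"
        by (simp add: A_def powr_add[symmetric] algebra_simps)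
      moreover have "exp (- u * S / 2) * exp (- d * u) = exp (- B * u)"
        by (simp add: B_def exp_add[symmetric] algebra_simps)
      ultimately show ?thesis
        unfolding gamma_kernel_def by (metis (no_types, lifting) mult.assoc mult.left_commute)
    qed
    have "rvm_likelihood K y \<beta> u * rvm_prior pl pu \<beta> u l
        \<le> (2 * pi) powr (- N / 2) * u powr (N / 2) * exp (- u * S / 2) * rvm_prior pl pu \<beta> u l"
      by (rule mult_right_mono[OF lik nonneg])
    also have "\<dots> = C * L l * (u powr (N / 2) * exp (- u * S / 2) * gamma_kernel c d u)
        * mvn_density 0 (matrix_inv (diag_mat l)) \<beta>"
      unfolding prior C_def by (simp only: mult_ac)
    finally show ?thesis
      unfolding gamma .
  qed

  have inner: "(\<integral>\<^sup>+ \<beta>. ennreal (rvm_likelihood K y \<beta> u * rvm_prior pl pu \<beta> u l) \<partial>lborel)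
      \<le> ennreal (C * L l) * ennreal (gamma_kernel A B u)"
    if u: "0 < u" and l: "\<And>i. 0 < l $ i" for u l
  proof -
    let ?v = "\<chi> i. 1 / l $ i"
    have v: "0 < ?v $ i" "l $ i \<noteq> 0" for i
      using l[of i] by auto
    have inv: "matrix_inv (diag_mat l) = diag_mat ?v"
      by (rule matrix_inv_diag_mat) (rule v)
    have meas: "(\<lambda>\<beta>. ennreal (mvn_density 0 (diag_mat ?v) \<beta>)) \<in> borel_measurable lborel"
      unfolding mvn_density_diag_mat[of ?v, OF v(1)] by measurable
    have nonneg: "0 \<le> C * L l" "0 \<le> gamma_kernel A B u"
      using C L by (auto simp: kernel_nonneg)
    have "(\<integral>\<^sup>+ \<beta>. ennreal (rvm_likelihood K y \<beta> u * rvm_prior pl pu \<beta> u l) \<partial>lborel)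
        \<le> (\<integral>\<^sup>+ \<beta>. ennreal (C * L l * gamma_kernel A B u) * ennreal (mvn_density 0 (diag_mat ?v) \<beta>) \<partial>lborel)"
      using pointwise[of u l] u l nonneg unfolding inv
      by (intro nn_integral_mono) (simp add: ennreal_mult'[symmetric] ennreal_leI)
    also have "\<dots> = ennreal (C * L l * gamma_kernel A B u)"
      using nn_integral_mvn_density_diag_mat[of ?v 0, OF v(1)] by (simp add: nn_integral_cmult[OF meas])
    finally show ?thesis
      using nonneg by (simp add: ennreal_mult)
  qed

  define I where "I = (\<integral>\<^sup>+ u\<in>{0<..}. ennreal (gamma_kernel A B u) \<partial>lborel)"
  define J where "J = (\<integral>\<^sup>+ t\<in>{0<..}. ennreal (gamma_kernel a b t) \<partial>lborel)"
  have "I < \<infinity>" "J < \<infinity>"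
    unfolding I_def J_def using i ii
    by (intro nn_integral_gamma_kernel_finite; simp add: A_def B_def N_def S_def)+
  have meas [measurable]: "(\<lambda>t. gamma_kernel p q t) \<in> borel_measurable borel" for p q
    unfolding gamma_kernel_def by measurable

  have middle: "(\<integral>\<^sup>+ u\<in>{0<..}. (\<integral>\<^sup>+ \<beta>. ennreal (rvm_likelihood K y \<beta> u * rvm_prior pl pu \<beta> u l)
        \<partial>lborel) \<partial>lborel) \<le> ennreal (C * L l) * I"
    if l: "\<And>i. 0 < l $ i" for l
  proof -
    have "(\<integral>\<^sup>+ u\<in>{0<..}. (\<integral>\<^sup>+ \<beta>. ennreal (rvm_likelihood K y \<beta> u * rvm_prior pl pu \<beta> u l)
          \<partial>lborel) \<partial>lborel)
        \<le> (\<integral>\<^sup>+ u. ennreal (C * L l) * (ennreal (gamma_kernel A B u) * indicator {0<..} u) \<partial>lborel)"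
      using inner l by (intro nn_integral_mono) (simp add: indicator_def)
    also have "\<dots> = ennreal (C * L l) * I"
      unfolding I_def by (rule nn_integral_cmult) measurable
    finally show ?thesis .
  qed

  let ?g = "\<lambda>t. ennreal (gamma_kernel a b t) * indicator {0<..} t"
  have "rvm_marginal K pl pu y
      \<le> (\<integral>\<^sup>+ l. ennreal C * I * (\<Prod>i\<in>UNIV. ?g (l $ i)) \<partial>(lborel :: (real ^ 'n option) measure))"
    unfolding rvm_marginal_def
  proof (rule nn_integral_mono)
    fix l :: "real ^ 'n option"
    show "(\<integral>\<^sup>+ u\<in>{0<..}. (\<integral>\<^sup>+ \<beta>. ennreal (rvm_likelihood K y \<beta> u * rvm_prior pl pu \<beta> u l)
          \<partial>lborel) \<partial>lborel) * indicator {l. \<forall>i. 0 < l $ i} l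
        \<le> ennreal C * I * (\<Prod>i\<in>UNIV. ?g (l $ i))"
    proof (cases "\<forall>i. 0 < l $ i")
      case True
      then have "(\<Prod>i\<in>UNIV. ?g (l $ i)) = ennreal (L l)"
        by (simp add: L_def prod_ennreal kernel_nonneg)
      then have "ennreal (C * L l) * I = ennreal C * I * (\<Prod>i\<in>UNIV. ?g (l $ i))"
        using C L by (simp add: ennreal_mult mult_ac)
      with middle[of l] True show ?thesis
        by simp
    qed simp
  qed
  also have "\<dots> = ennreal C * I * (\<integral>\<^sup>+ l. (\<Prod>i\<in>UNIV. ?g (l $ i)) \<partial>(lborel :: (real ^ 'n option) measure))"
    by (rule nn_integral_cmult) measurable
  also have "\<dots> = ennreal C * I * J ^ CARD('n option)"
    by (subst nn_integral_lborel_prod_vec) (auto simp: J_def)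
  also have "\<dots> < \<infinity>"
    using \<open>I < \<infinity>\<close> \<open>J < \<infinity>\<close> by (simp add: ennreal_mult_less_top power_less_top_ennreal)
  finally show ?thesis .
qed

end
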